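(* For $a\in(0,1/2]$ and $r\in(0,1)$, let $r_0=r^*=\sqrt[3]{1-r^3}$ and, for $n\ge 1$, $$r_n=\frac{\sqrt[3]{9r_{n-1}(1+r_{n-1}+r_{n-1}^2)}}{1+2r_{n-1}}.$$ Then $$\prod_{n=0}^{\infty}\left[(1+2r_n)(1+r_n+r_n^2)\right]^{\frac{3^{-n}}{2}}\le \exp\left(\mu_a^*(r)+\tfrac32\log r\right)\le \frac{1}{\sqrt{27}}\exp\left(R(a)/2\right)\prod_{n=0}^{\infty}\left[(1+2r_n)(1+r_n+r_n^2)\right]^{\frac{3^{-n}}{2}}\qquad (\mathrm{I})$$ for $a\in(0,1/3]$, and the reversed inequality $$\frac{1}{\sqrt{27}}\exp\left(R(a)/2\right)\prod_{n=0}^{\infty}\left[(1+2r_n)(1+r_n+r_n^2)\right]^{\frac{3^{-n}}{2}}\le \exp\left(\mu_a^*(r)+\tfrac32\log r\right)\le \prod_{n=0}^{\infty}\left[(1+2r_n)(1+r_n+r_n^2)\right]^{\frac{3^{-n}}{2}}\qquad (\mathrm{II})$$ holds for $a\in[1/3,1/2]$. Moreover, each equality in (I) and (II) is reached if and only if $a=1/3$. In particular, for all $r\in(0,1)$, $$\exp\left(\mu^*(r)+\tfrac32\log r\right)=\exp\left(\mu_{1/3}(r^{3/2})+\tfrac32\log r\right)=\prod_{n=0}^{\infty}\left[(1+2r_n)(1+r_n+r_n^2)\right]^{\frac{3^{-n}}{2}},$$ or, equivalently, $$\mu^*(r)+\tfrac32\log r=\mu_{1/3}(r^{3/2})+\tfrac32\log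 r=\frac12\sum_{n=0}^{\infty}\frac{1}{3^n}\log\left[(1+2r_n)(1+r_n+r_n^2)\right].$$
   Context: $F(a,b;c;x)=\sum_{n=0}^\infty \frac{(a,n)(b,n)}{(c,n)}\frac{x^n}{n!}$ is the Gaussian hypergeometric function, where $(a,n)=a(a+1)\cdots(a+n-1)$, $(a,0)=1$. For $a\in(0,1/2]$ and $r\in(0,1)$: $\mu_a(r)=\frac{\pi}{2\sin(\pi a)}\frac{F(a,1-a;1;1-r^2)}{F(a,1-a;1;r^2)}$, $\mu_a^*(r)=\mu_a(r^{3/2})=\frac{\pi}{2\sin(\pi a)}\frac{F(a,1-a;1;1-r^3)}{F(a,1-a;1;r^3)}$, and $\mu^*(r)=\mu_{1/3}^*(r)$. With $\varphi_K^*(r)=(\mu^* )^{-1}(\mu^*(r)/K)$, one has $r_n=\varphi_3^*(r_{n-1})=\varphi_{3^n}^*(r^* )$. $R(a)=-2\gamma-\Psi(a)-\Psi(1-a)$, where $\Psi=\Gamma'/\Gamma$ is the psi (digamma) function and $\gamma$ is the Euler–Mascheroni constant. *)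

theory Defs
  imports "HOL-Analysis.Analysis"
begin

definition gauss_F :: "real \<Rightarrow> real \<Rightarrow> real \<Rightarrow> real \<Rightarrow> real" where
  "gauss_F a b c x =
     (\<Sum>n. pochhammer a n * pochhammer b n / pochhammer c n * (x ^ n / fact n))"

text \<open>The generalized Groetzsch ring function and its cubic version; both are meaningful
  for \<open>0 < a \<le> 1/2\<close> and \<open>0 < r < 1\<close> only.\<close>

definition mu :: "real \<Rightarrow> real \<Rightarrow> real" where
  "mu a r = pi / (2 * sin (pi * a)) *
     (gauss_F a (1 - a) 1 (1 - r\<^sup>2) / gauss_F a (1 - a) 1 (r\<^sup>2))"

definition mu_star :: "real \<Rightarrow> real \<Rightarrow> real" where
  "mu_star a r = mu a (r powr (3/2))"

definition ramanujan_R :: "real \<Rightarrow> real" where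
  "ramanujan_R a = - 2 * euler_mascheroni - Digamma a - Digamma (1 - a)"

primrec cubic_seq :: "real \<Rightarrow> nat \<Rightarrow> real" where
  "cubic_seq r 0 = root 3 (1 - r ^ 3)"
| "cubic_seq r (Suc n) =
     root 3 (9 * cubic_seq r n * (1 + cubic_seq r n + (cubic_seq r n)\<^sup>2))
       / (1 + 2 * cubic_seq r n)"

definition cubic_base :: "real \<Rightarrow> nat \<Rightarrow> real" where
  "cubic_base r n =
     (1 + 2 * cubic_seq r n) * (1 + cubic_seq r n + (cubic_seq r n)\<^sup>2)"

definition cubic_factor :: "real \<Rightarrow> nat \<Rightarrow> real" where
  "cubic_factor r n = cubic_base r n powr (3 powi (- int n) / 2)"

end

theory Submission
  imports Defs
begin

text \<open>Write \<open>F\<close> for \<open>F(a,1-a;1;t)\<close> and \<open>m\<^sub>a(t) = \<mu>\<^sub>a(\<surd>t)\<close>. The self-adjoint form of the hypergeometric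
  equation and the behaviour \<open>F(1-t) = sin(\<pi>a)/\<pi> (R(a) - ln t) + o(1)\<close> at \<open>0\<close> give
  \<open>m\<^sub>a'(t) = -1/(2t(1-t)F(t)\<^sup>2)\<close>. Since \<open>F\<close> increases strictly with \<open>a\<close> on \<open>(0,1/2]\<close>, the difference
  \<open>m\<^sub>a - m\<^sub>b\<close> is strictly decreasing in \<open>t\<close> for \<open>a < b\<close>, with limits \<open>(R(a) - R(b))/2\<close> at \<open>0\<close> and \<open>0\<close> at \<open>1\<close>;
  taking \<open>1/3\<close> for one of the parameters gives both inequalities, because \<open>R(1/3) = ln 27\<close>.
  For \<open>a = 1/3\<close> the cubic transformation yields \<open>m(1 - r\<^sub>n\<^sup>3) = 3\<^sup>n m(r\<^sup>3)\<close>, and the product is read off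
  from \<open>m(t) + (ln t)/2 = O(1)\<close> along \<open>t = 1 - r\<^sub>n\<^sup>3\<close>, which tends to \<open>0\<close>.\<close>

section \<open>Limits under the summation sign\<close>

text \<open>Dominated convergence for series: a majorant that eventually holds for all
  \<open>k\<close> at once supplies the bound on the product filter in Tannery's theorem.\<close>

lemma tannery_uniform:
  fixes f :: "nat \<Rightarrow> 'b \<Rightarrow> real"
  assumes "\<And>k. (f k \<longlongrightarrow> b k) F"
    and "eventually (\<lambda>x. \<forall>k. \<bar>f k x\<bar> \<le> M k) F"
    and "summable M" "F \<noteq> bot"
  shows "((\<lambda>x. \<Sum>k. f k x) \<longlongrightarrow> suminf b) F"
proof -
  have "eventually (\<lambda>(k,n). norm (f k n) \<le> M k) (at_top \<times>\<^sub>F F)"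
    unfolding eventually_prod_filter
    using assms(2) by (intro exI[of _ "\<lambda>_. True"] exI[of _ "\<lambda>x. \<forall>k. \<bar>f k x\<bar> \<le> M k"]) auto
  from tannerys_theorem[OF assms(1) this assms(3,4)] show ?thesis by simp
qed

text \<open>The absolutely convergent case of Abel's theorem: on (0,1) the moduli of the
  coefficients are themselves a majorant.\<close>

lemma tendsto_power_series_at_left_1:
  fixes d :: "nat \<Rightarrow> real"
  assumes "summable (\<lambda>n. \<bar>d n\<bar>)"
  shows "((\<lambda>x. \<Sum>n. d n * x ^ n) \<longlongrightarrow> suminf d) (at_left 1)"
proof (rule tannery_uniform[OF _ _ assms])
  show "((\<lambda>x. d k * x ^ k) \<longlongrightarrow> d k) (at_left 1)" for k
    by (rule tendsto_eq_intros refl | simp)+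
  have "eventually (\<lambda>x::real. x \<in> {0<..<1}) (at_left 1)"
    by (rule eventually_at_left_real) simp
  thus "eventually (\<lambda>x. \<forall>k. \<bar>d k * x ^ k\<bar> \<le> \<bar>d k\<bar>) (at_left 1)"
    by eventually_elim (auto simp: abs_mult power_abs mult_left_le power_le_one)
qed simp

section \<open>The zero-balanced hypergeometric series\<close>

definition hyp_coeff :: "real \<Rightarrow> nat \<Rightarrow> real" where
  "hyp_coeff a n = pochhammer a n * pochhammer (1 - a) n / (fact n)\<^sup>2"

abbreviation hyp :: "real \<Rightarrow> real \<Rightarrow> real" where
  "hyp a \<equiv> gauss_F a (1 - a) 1"

lemma hyp_eq: "hyp a x = (\<Sum>n. hyp_coeff a n * x ^ n)"
  by (simp add: gauss_F_def hyp_coeff_def pochhammer_fact[symmetric] power2_eq_square)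

lemma hyp_coeff_0 [simp]: "hyp_coeff a 0 = 1"
  by (simp add: hyp_coeff_def)

text \<open>Since (a+n)(1-a+n) = n^2 + n + a(1-a), the parameter enters the recurrence only through
  a(1-a).\<close>

lemma hyp_coeff_Suc:
  "hyp_coeff a (Suc n) = hyp_coeff a n * ((real n)\<^sup>2 + n + a * (1 - a)) / (real n + 1)\<^sup>2"
  by (simp add: hyp_coeff_def pochhammer_Suc field_simps power2_eq_square)

text \<open>The integrated form of (x(1-x)F')' = a(1-a)F, read off at x^(n+1). It also controls the
  growth of n c_n, where c_n is \<open>hyp_coeff a n\<close>.\<close>

lemma hyp_coeff_weighted_diff:
  "real (Suc n) * hyp_coeff a (Suc n) - n * hyp_coeff a n = a * (1 - a) * (hyp_coeff a n / (real n + 1))"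
proof -
  have "x * (c * ((x - 1)\<^sup>2 + (x - 1) + b) / x\<^sup>2) - (x - 1) * c = b * (c / x)"
    if "x > 0" for x c b :: real
    using that by (simp add: field_simps power2_eq_square)
  from this[of "real n + 1" "hyp_coeff a n" "a * (1 - a)"] show ?thesis
    by (simp add: hyp_coeff_Suc add_ac)
qed

definition hyp_deriv :: "real \<Rightarrow> real \<Rightarrow> real" where
  "hyp_deriv a x = (\<Sum>n. diffs (hyp_coeff a) n * x ^ n)"

text \<open>The hypergeometric equation is used in its self-adjoint form
  \<open>(x(1-x)F')' = a(1-a)F\<close>; \<open>hyp_flux\<close> is \<open>x(1-x)F'\<close>.\<close>

definition hyp_flux_coeff :: "real \<Rightarrow> nat \<Rightarrow> real" where
  "hyp_flux_coeff a n = (case n of 0 \<Rightarrow> 0 | Suc m \<Rightarrow> a * (1 - a) * (hyp_coeff a m / (real m + 1)))"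

definition hyp_flux :: "real \<Rightarrow> real \<Rightarrow> real" where
  "hyp_flux a x = (\<Sum>n. hyp_flux_coeff a n * x ^ n)"

text \<open>By the reflection formula this is 1/(\<Gamma>(a)\<Gamma>(1-a)). Below it is called
  \<kappa>; it is the limit of n c_n and hence the weight of the logarithm of F at 1.\<close>

definition reflection_const :: "real \<Rightarrow> real" where
  "reflection_const a = sin (pi * a) / pi"

text \<open>The coefficients of -\<kappa> ln(1-x) - F(x). At n = 0 the quotient is 0 by convention,
  so the entry is -1, as the constant term of F demands.\<close>

definition hyp_defect :: "real \<Rightarrow> nat \<Rightarrow> real" where
  "hyp_defect a n = reflection_const a / n - hyp_coeff a n"

definition hyp_log_const :: "real \<Rightarrow> real" where
  "hyp_log_const a = - suminf (hyp_defect a)"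

context
  fixes a :: real
  assumes a: "0 < a" "a < 1"
begin

lemma parameter_product: "0 < a * (1 - a)" "a * (1 - a) \<le> 1"
  using a mult_le_one[of a "1-a"] by auto

lemma hyp_coeff_pos: "hyp_coeff a n > 0"
  using a by (auto simp: hyp_coeff_def intro!: divide_pos_pos mult_pos_pos pochhammer_pos)

lemma hyp_coeff_le_1: "hyp_coeff a n \<le> 1"
proof (induction n)
  case (Suc n)
  have "hyp_coeff a (Suc n) \<le> 1 * ((real n)\<^sup>2 + n + a * (1 - a)) / (real n + 1)\<^sup>2"
    unfolding hyp_coeff_Suc using Suc parameter_product
    by (intro divide_right_mono mult_right_mono) auto
  also have "\<dots> \<le> 1"
  proof -
    have "(real n)\<^sup>2 + n + a * (1 - a) \<le> (real n)\<^sup>2 + 2 * n + 1"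
      using parameter_product(2) by linarith
    also have "\<dots> = (real n + 1)\<^sup>2" by (simp add: power2_eq_square algebra_simps)
    finally show ?thesis by (simp add: divide_le_eq_1)
  qed
  finally show ?case .
qed simp

lemma summable_hyp: "\<bar>x\<bar> < 1 \<Longrightarrow> summable (\<lambda>n. hyp_coeff a n * x ^ n)"
proof (rule summable_comparison_test')
  show "norm (hyp_coeff a n * x ^ n) \<le> \<bar>x\<bar> ^ n" for n
    using hyp_coeff_pos[of n] hyp_coeff_le_1[of n]
    by (simp add: abs_mult power_abs mult_left_le_one_le)
qed (simp add: summable_geometric)

lemma hyp_0: "hyp a 0 = 1"
  unfolding hyp_eq using powser_zero[of "hyp_coeff a"] by simp

lemma hyp_ge_1: "0 \<le> x \<Longrightarrow> x < 1 \<Longrightarrow> hyp a x \<ge> 1"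
  unfolding hyp_eq using sum_le_suminf[OF summable_hyp, of x "{0}"]
  by (auto simp: less_imp_le[OF hyp_coeff_pos])

section \<open>Derivatives and the self-adjoint hypergeometric equation\<close>

lemma has_field_derivative_hyp_aux:
  "\<bar>x\<bar> < 1 \<Longrightarrow> (hyp a has_real_derivative hyp_deriv a x) (at x)"
  unfolding hyp_deriv_def hyp_eq[abs_def]
  by (rule termdiffs_strong'[where K = 1]) (auto intro: summable_hyp)

lemma hyp_flux_coeff_nonneg: "hyp_flux_coeff a n \<ge> 0"
proof (cases n)
  case (Suc m)
  thus ?thesis using parameter_product hyp_coeff_pos[of m] unfolding Suc hyp_flux_coeff_def nat.case
    by (intro mult_nonneg_nonneg[of "a * (1 - a)"]) auto
qed (simp add: hyp_flux_coeff_def)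

lemma hyp_flux_coeff_le_1: "hyp_flux_coeff a n \<le> 1"
proof (cases n)
  case (Suc m)
  have "hyp_coeff a m / (real m + 1) \<le> 1"
    using hyp_coeff_le_1[of m] by simp
  thus ?thesis
    using parameter_product hyp_coeff_pos[of m] unfolding Suc hyp_flux_coeff_def nat.case
    by (intro mult_le_one[of "a * (1 - a)"]) auto
qed (simp add: hyp_flux_coeff_def)

lemma summable_hyp_flux: "\<bar>x\<bar> < 1 \<Longrightarrow> summable (\<lambda>n. hyp_flux_coeff a n * x ^ n)"
proof (rule summable_comparison_test')
  show "norm (hyp_flux_coeff a n * x ^ n) \<le> \<bar>x\<bar> ^ n" for n
    using hyp_flux_coeff_nonneg[of n] hyp_flux_coeff_le_1[of n]
    by (simp add: abs_mult power_abs mult_left_le_one_le)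
qed (simp add: summable_geometric)

lemma hyp_flux_0: "hyp_flux a 0 = 0"
  unfolding hyp_flux_def using powser_zero[of "hyp_flux_coeff a"] by (simp add: hyp_flux_coeff_def)

lemma has_field_derivative_hyp_flux:
  assumes "\<bar>x\<bar> < 1"
  shows "(hyp_flux a has_real_derivative a * (1 - a) * hyp a x) (at x)"
proof -
  have *: "diffs (hyp_flux_coeff a) n = a * (1 - a) * hyp_coeff a n" for n
    by (simp add: diffs_def hyp_flux_coeff_def field_simps)
  have "(hyp_flux a has_real_derivative (\<Sum>n. diffs (hyp_flux_coeff a) n * x ^ n)) (at x)"
    unfolding hyp_flux_def[abs_def]
    by (rule termdiffs_strong'[where K = 1]) (use assms in \<open>auto intro: summable_hyp_flux\<close>)
  also have "(\<Sum>n. diffs (hyp_flux_coeff a) n * x ^ n) = (\<Sum>n. a * (1 - a) * (hyp_coeff a n * x ^ n))"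
    by (simp add: * mult.assoc)
  also have "\<dots> = a * (1 - a) * hyp a x"
    unfolding hyp_eq by (rule suminf_mult) (use assms in \<open>auto intro: summable_hyp\<close>)
  finally show ?thesis .
qed

lemma hyp_flux_eq:
  assumes x: "\<bar>x\<bar> < 1"
  shows "hyp_flux a x = x * (1 - x) * hyp_deriv a x"
proof -
  let ?e = "\<lambda>n. n * hyp_coeff a n"
  have sd: "summable (\<lambda>n. diffs (hyp_coeff a) n * x ^ n)"
    using x by (intro termdiff_converges[where K = 1]) (auto intro: summable_hyp)
  hence 1: "(\<lambda>n. x * (diffs (hyp_coeff a) n * x ^ n)) sums (x * hyp_deriv a x)"
    unfolding hyp_deriv_def by (intro sums_mult summable_sums)
  have 2: "(\<lambda>n. ?e (Suc n) * x ^ Suc n) sums (x * hyp_deriv a x)"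
    using 1 by (simp add: diffs_def mult_ac)
  hence 3: "(\<lambda>n. ?e n * x ^ n) sums (x * hyp_deriv a x)"
    by (subst (asm) sums_Suc_iff) simp
  \<comment> \<open>Facts 2 and 3 are the same series for xF' with indices shifted by one; 2 minus x
    times 3 gives x(1-x)F' with the differences of n c_n as coefficients.\<close>
  from sums_diff[OF 2 sums_mult[OF 3, of x]]
  have "(\<lambda>n. (?e (Suc n) - ?e n) * x ^ Suc n) sums (x * (1 - x) * hyp_deriv a x)"
    by (simp add: algebra_simps)
  hence "(\<lambda>n. hyp_flux_coeff a (Suc n) * x ^ Suc n) sums (x * (1 - x) * hyp_deriv a x)"
    unfolding hyp_coeff_weighted_diff by (simp add: hyp_flux_coeff_def add_ac)
  hence "(\<lambda>n. hyp_flux_coeff a n * x ^ n) sums (x * (1 - x) * hyp_deriv a x)"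
    by (subst (asm) sums_Suc_iff) (simp add: hyp_flux_coeff_def)
  thus ?thesis by (simp add: hyp_flux_def sums_iff)
qed

lemma has_field_derivative_hyp:
  assumes "0 < x" "x < 1"
  shows "(hyp a has_real_derivative hyp_flux a x / (x * (1 - x))) (at x)"
  using has_field_derivative_hyp_aux[of x] hyp_flux_eq[of x] assms by simp

lemma isCont_hyp: "\<bar>x\<bar> < 1 \<Longrightarrow> isCont (hyp a) x"
  using has_field_derivative_hyp_aux by (rule DERIV_isCont)

lemma isCont_hyp_flux: "\<bar>x\<bar> < 1 \<Longrightarrow> isCont (hyp_flux a) x"
  using has_field_derivative_hyp_flux by (rule DERIV_isCont)

section \<open>Growth of the coefficients and the logarithmic singularity at 1\<close>

lemma reflection_const_eq: "reflection_const a = rGamma a * rGamma (1 - a)"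
proof -
  have "complex_of_real (rGamma a * rGamma (1 - a)) = complex_of_real (sin (pi * a) / pi)"
    using rGamma_reflection_complex[of "complex_of_real a"]
    by (simp add: rGamma_complex_of_real[symmetric] sin_of_real[symmetric] del: sin_of_real)
  thus ?thesis unfolding reflection_const_def of_real_eq_iff by simp
qed

lemma reflection_const_pos: "reflection_const a > 0"
  unfolding reflection_const_def using a by (auto intro!: divide_pos_pos sin_gt_zero)

text \<open>Multiply Euler's product limits for 1/\<Gamma>(a) and 1/\<Gamma>(1-a): the powers n^a
  and n^(1-a) combine to n, and n/(n+1) corrects the index shift.\<close>

lemma weighted_hyp_coeff_LIMSEQ: "(\<lambda>n. n * hyp_coeff a n) \<longlonglongrightarrow> reflection_const a"
proof (subst filterlim_sequentially_Suc[symmetric])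
  have "(\<lambda>n. rGamma_series a n * rGamma_series (1 - a) n * (real n / real (Suc n)))
          \<longlonglongrightarrow> rGamma a * rGamma (1 - a) * 1"
    by (intro tendsto_mult rGamma_series_LIMSEQ LIMSEQ_n_over_Suc_n)
  moreover have "eventually (\<lambda>n. rGamma_series a n * rGamma_series (1 - a) n * (real n / real (Suc n))
      = real (Suc n) * hyp_coeff a (Suc n)) sequentially"
    using eventually_gt_at_top[of 0]
  proof eventually_elim
    case (elim n)
    have "exp (a * ln (real n)) * exp ((1 - a) * ln (real n)) = n"
      using elim by (simp add: exp_add[symmetric] algebra_simps)
    moreover have "rGamma_series a n * rGamma_series (1 - a) n =
      pochhammer a (n+1) * pochhammer (1 - a) (n+1) /
        ((fact n)\<^sup>2 * (exp (a * ln (real n)) * exp ((1 - a) * ln (real n))))"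
      by (simp add: rGamma_series_def power2_eq_square)
    ultimately have "rGamma_series a n * rGamma_series (1 - a) n =
      pochhammer a (n+1) * pochhammer (1 - a) (n+1) / ((fact n)\<^sup>2 * n)" by simp
    thus ?case using elim
      by (simp add: hyp_coeff_def power2_eq_square divide_simps) (simp only: mult_ac)
  qed
  ultimately show "(\<lambda>n. real (Suc n) * hyp_coeff a (Suc n)) \<longlonglongrightarrow> reflection_const a"
    using Lim_transform_eventually unfolding reflection_const_eq by fastforce
qed

lemma weighted_hyp_coeff_mono: "m \<le> n \<Longrightarrow> m * hyp_coeff a m \<le> n * hyp_coeff a n"
proof (induction n rule: dec_induct)
  case (step n)
  have "0 \<le> real (Suc n) * hyp_coeff a (Suc n) - n * hyp_coeff a n"
    using hyp_flux_coeff_nonneg[of "Suc n"] unfolding hyp_coeff_weighted_diff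
    by (simp add: hyp_flux_coeff_def)
  with step.IH show ?case by linarith
qed simp

lemma weighted_hyp_coeff_le: "n * hyp_coeff a n \<le> reflection_const a"
  by (rule LIMSEQ_le_const[OF weighted_hyp_coeff_LIMSEQ])
     (use weighted_hyp_coeff_mono in blast)

text \<open>The flux coefficients are the increments of n c_n, so the sum telescopes; this gives the
  limit of x(1-x)F' at 1.\<close>

lemma sums_hyp_flux_coeff: "hyp_flux_coeff a sums reflection_const a"
proof -
  have "hyp_flux_coeff a (Suc n) = Suc n * hyp_coeff a (Suc n) - n * hyp_coeff a n" for n
    unfolding hyp_coeff_weighted_diff by (simp add: hyp_flux_coeff_def)
  hence "(\<lambda>n. hyp_flux_coeff a (Suc n)) sums (reflection_const a - 0 * hyp_coeff a 0)"
    using telescope_sums[OF weighted_hyp_coeff_LIMSEQ] by simp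
  thus ?thesis by (subst (asm) sums_Suc_iff) (simp add: hyp_flux_coeff_def)
qed

lemma hyp_flux_tendsto: "(hyp_flux a \<longlongrightarrow> reflection_const a) (at_left 1)"
proof -
  have "summable (\<lambda>n. \<bar>hyp_flux_coeff a n\<bar>)"
    using sums_summable[OF sums_hyp_flux_coeff] by (simp add: hyp_flux_coeff_nonneg)
  from tendsto_power_series_at_left_1[OF this] show ?thesis
    using sums_unique[OF sums_hyp_flux_coeff] by (simp add: hyp_flux_def[abs_def])
qed

text \<open>Both \<open>n c\<^sub>n\<close> and \<open>n c\<^sub>n + \<kappa>/n\<close> are monotone with limit
  \<open>\<kappa> = sin(\<pi>a)/\<pi>\<close>, from below and from above.\<close>

lemma hyp_defect_bounds:
  assumes "n > 0"
  shows "0 \<le> hyp_defect a n" "hyp_defect a n \<le> reflection_const a * (1 / (real n)\<^sup>2)"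
proof -
  show "0 \<le> hyp_defect a n"
    using weighted_hyp_coeff_le[of n] assms by (simp add: hyp_defect_def field_simps)
  define f where "f m = m * hyp_coeff a m + reflection_const a / m" for m :: nat
  have f_Suc: "f (Suc m) \<le> f m" if "m > 0" for m
  proof -
    have "real (Suc m) * hyp_coeff a (Suc m) - m * hyp_coeff a m = a * (1 - a) * (hyp_coeff a m / (real m + 1))"
      by (rule hyp_coeff_weighted_diff)
    also have "\<dots> \<le> 1 * (hyp_coeff a m / (real m + 1))"
      using parameter_product hyp_coeff_pos[of m] by (intro mult_right_mono) auto
    also have "\<dots> \<le> (reflection_const a / m) / (real m + 1)"
      using weighted_hyp_coeff_le[of m] that
      by (simp add: divide_right_mono le_divide_eq mult.commute)
    also have "\<dots> = reflection_const a / m - reflection_const a / Suc m"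
      using that by (simp add: field_simps)
    finally show ?thesis by (simp add: f_def)
  qed
  have "f k \<le> f n" if "k \<ge> n" for k
    using that
  proof (induction k rule: dec_induct)
    case (step m)
    thus ?case using f_Suc[of m] assms by simp
  qed simp
  moreover have "f \<longlonglongrightarrow> reflection_const a + 0"
    unfolding f_def by (intro tendsto_add weighted_hyp_coeff_LIMSEQ lim_const_over_n)
  ultimately have "reflection_const a \<le> f n"
    by (intro LIMSEQ_le_const2[of f]) auto
  hence "reflection_const a / n \<le> f n / n"
    by (rule divide_right_mono) simp
  thus "hyp_defect a n \<le> reflection_const a * (1 / (real n)\<^sup>2)"
    using assms by (simp add: hyp_defect_def f_def add_divide_distrib power2_eq_square)
qed

lemma summable_hyp_defect: "summable (\<lambda>n. \<bar>hyp_defect a n\<bar>)"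
proof (rule summable_comparison_test'[where N = 1])
  show "summable (\<lambda>n. reflection_const a * (1 / (real n)\<^sup>2))"
    using inverse_power_summable[of 2, where 'a = real] by (intro summable_mult) (simp add: inverse_eq_divide)
  show "norm \<bar>hyp_defect a n\<bar> \<le> reflection_const a * (1 / (real n)\<^sup>2)" if "1 \<le> n" for n
    using hyp_defect_bounds[of n] that by simp
qed

text \<open>Removing \<kappa>/n from each coefficient leaves an O(1/n^2) remainder, whose power
  series is continuous up to 1.\<close>

lemma hyp_log_asymptotic:
  "((\<lambda>x. hyp a x + reflection_const a * ln (1 - x)) \<longlongrightarrow> hyp_log_const a) (at_left 1)"
proof -
  have "((\<lambda>x. - (\<Sum>n. hyp_defect a n * x ^ n)) \<longlongrightarrow> hyp_log_const a) (at_left 1)"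
    unfolding hyp_log_const_def
    by (intro tendsto_minus tendsto_power_series_at_left_1 summable_hyp_defect)
  moreover have "eventually (\<lambda>x::real. x \<in> {0<..<1}) (at_left 1)"
    by (rule eventually_at_left_real) simp
  hence "eventually (\<lambda>x. - (\<Sum>n. hyp_defect a n * x ^ n) = hyp a x + reflection_const a * ln (1 - x)) (at_left 1)"
  proof eventually_elim
    case (elim x)
    have "(\<lambda>n. - (x ^ n) / n) sums ln (1 - x)"
      using ln_series'[of "-x"] elim by (simp add: power_minus'[of x] mult.assoc power_mult_distrib[symmetric] minus_one_power_iff)
    hence "(\<lambda>n. hyp_coeff a n * x ^ n + reflection_const a * (- (x ^ n) / n)) sums
             (hyp a x + reflection_const a * ln (1 - x))"
      unfolding hyp_eq using elim by (intro sums_add sums_mult summable_sums summable_hyp) auto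
    hence "(\<lambda>n. - (hyp_defect a n * x ^ n)) sums (hyp a x + reflection_const a * ln (1 - x))"
      by (simp add: hyp_defect_def algebra_simps)
    thus ?case using sums_minus sums_unique by fastforce
  qed
  ultimately show ?thesis by (rule Lim_transform_eventually)
qed

end

section \<open>The constant in the logarithmic singularity\<close>

lemma binomial_series_neg:
  fixes t :: real
  assumes "\<bar>t\<bar> < 1"
  shows "(\<lambda>n. pochhammer a n / fact n * t ^ n) sums (1 - t) powr (- a)"
proof -
  have "(- a gchoose n) * (- t) ^ n = pochhammer a n / fact n * t ^ n" for n
  proof -
    have "(- a gchoose n) * (- t) ^ n = ((- 1) ^ n * (- t) ^ n) * (pochhammer a n / fact n)"
      by (simp add: gbinomial_pochhammer)
    also have "(- 1) ^ n * (- t) ^ n = t ^ n"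
      by (simp flip: power_mult_distrib)
    finally show ?thesis by simp
  qed
  thus ?thesis using gen_binomial_real[of "-t" "-a"] assms by simp
qed

text \<open>Euler's integral at argument 1: expand (1-t)^(-a) against the Beta kernel
  \<open>k\<close> and integrate termwise. All terms are nonnegative, so monotone convergence
  applies to the partial sums \<open>f\<close>, with limit \<open>g\<close>.\<close>

theorem gauss_summation:
  fixes a b c :: real
  assumes "0 < a" "0 < b" "a + b < c"
  shows "(\<lambda>n. pochhammer a n * pochhammer b n / (pochhammer c n * fact n)) sums
           (Beta b (c - a - b) / Beta b (c - b))"
proof -
  define k where "k t = t powr (b - 1) * (1 - t) powr (c - b - 1)" for t :: real
  define f where "f m t = (\<Sum>n<m. pochhammer a n / fact n * t ^ n) * k t" for m t
  define g where "g t = t powr (b - 1) * (1 - t) powr (c - a - b - 1)" for t :: real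
  have Beta_pos: "Beta b (c - b) > 0"
    using assms by (auto simp: Beta_def intro!: divide_pos_pos mult_pos_pos Gamma_real_pos)
  \<comment> \<open>The moments of the Beta kernel produce the Pochhammer quotients of the
    series.\<close>
  have k_int: "((\<lambda>t. t ^ n * k t) has_integral Beta b (c - b) * (pochhammer b n / pochhammer c n)) {0<..<1}" for n
  proof -
    have "((\<lambda>t. t powr (b + n - 1) * (1 - t) powr (c - b - 1)) has_integral Beta (b + n) (c - b)) {0<..<1}"
      using has_integral_Beta_real[of "b + n" "c - b"] assms by (simp add: has_integral_Icc_iff_Ioo)
    also have "Beta (b + n) (c - b) = Beta b (c - b) * (pochhammer b n / pochhammer c n)"
    proof -
      have "b \<notin> \<int>\<^sub>\<le>\<^sub>0" "c \<notin> \<int>\<^sub>\<le>\<^sub>0"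
        using assms by (auto dest: nonpos_Ints_nonpos)
      moreover have "Gamma b > 0" "Gamma c > 0"
        using assms by (auto intro!: Gamma_real_pos)
      ultimately show ?thesis by (simp add: Beta_def pochhammer_Gamma add_ac)
    qed
    finally show ?thesis
      by (rule has_integral_eq[rotated])
         (simp add: k_def powr_realpow[symmetric] mult.assoc[symmetric] powr_add[symmetric] algebra_simps)
  qed
  have f_int: "(f m has_integral
      (\<Sum>n<m. Beta b (c - b) * (pochhammer a n * pochhammer b n / (pochhammer c n * fact n)))) {0<..<1}" for m
  proof -
    have "((\<lambda>t. \<Sum>n<m. pochhammer a n / fact n * (t ^ n * k t)) has_integral
      (\<Sum>n<m. pochhammer a n / fact n * (Beta b (c - b) * (pochhammer b n / pochhammer c n)))) {0<..<1}"
      by (intro has_integral_sum has_integral_mult_right k_int) auto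
    thus ?thesis by (simp add: f_def[abs_def] sum_distrib_left sum_distrib_right mult_ac)
  qed
  have g_int: "(g has_integral Beta b (c - a - b)) {0<..<1}"
    using has_integral_Beta_real[of b "c - a - b"] assms
    unfolding g_def by (simp add: has_integral_Icc_iff_Ioo)
  have fg: "(\<lambda>m. f m t) \<longlonglongrightarrow> g t" if t: "t \<in> {0<..<1}" for t
  proof -
    have "(\<lambda>m. f m t) \<longlonglongrightarrow> (1 - t) powr (- a) * k t"
      unfolding f_def using binomial_series_neg[of t a] t
      by (intro tendsto_mult tendsto_const) (auto simp: sums_def)
    also have "(1 - t) powr (- a) * k t = g t"
      by (simp add: g_def k_def powr_add[symmetric] algebra_simps)
    finally show ?thesis .
  qed
  have mono: "f m t \<le> f (Suc m) t" if "t \<in> {0<..<1}" for m t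
    using that assms by (auto simp: f_def k_def intro!: mult_right_mono mult_nonneg_nonneg divide_nonneg_nonneg pochhammer_nonneg)
  have f_le: "f m t \<le> g t" if "t \<in> {0<..<1}" for m t
    using fg[OF that] incseq_SucI[of "\<lambda>m. f m t", OF mono[OF that]] incseq_le by blast
  have f_nonneg: "0 \<le> f m t" if "t \<in> {0<..<1}" for m t
    using that assms by (auto simp: f_def k_def intro!: mult_nonneg_nonneg sum_nonneg divide_nonneg_nonneg pochhammer_nonneg)
  have "bounded (range (\<lambda>m. integral {0<..<1} (f m)))"
  proof (rule boundedI)
    show "norm y \<le> Beta b (c - a - b)" if "y \<in> range (\<lambda>m. integral {0<..<1} (f m))" for y
      using that has_integral_le[OF f_int g_int f_le] has_integral_nonneg[OF f_int f_nonneg]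
        integral_unique[OF f_int] by auto
  qed
  with f_int mono fg have "(\<lambda>m. integral {0<..<1} (f m)) \<longlonglongrightarrow> integral {0<..<1} g"
    by (intro monotone_convergence_increasing[THEN conjunct2]) (auto simp: integrable_on_def)
  hence "(\<lambda>n. Beta b (c - b) * (pochhammer a n * pochhammer b n / (pochhammer c n * fact n))) sums
           Beta b (c - a - b)"
    unfolding sums_def integral_unique[OF f_int] integral_unique[OF g_int] .
  from sums_divide[OF this, of "Beta b (c - b)"] Beta_pos show ?thesis by simp
qed

section \<open>Regularization by shifting the third parameter\<close>

text \<open>The factor (1,n)/(1+e,n) by which a term at 1 changes when the third parameter moves
  from 1 to 1+e.\<close>

definition gauss_weight :: "nat \<Rightarrow> real \<Rightarrow> real" where
  "gauss_weight n e = fact n / pochhammer (1 + e) n"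

lemma gauss_weight_bounds:
  assumes "e > 0"
  shows "0 < gauss_weight n e" "gauss_weight n e \<le> 1"
proof -
  have "(fact n :: real) \<le> pochhammer (1 + e) n"
  proof (induction n)
    case (Suc n)
    have "fact n * (1 + real n) \<le> pochhammer (1 + e) n * (1 + e + real n)"
      using Suc assms by (intro mult_mono) (auto intro: pochhammer_nonneg)
    thus ?case by (simp add: pochhammer_Suc mult.commute)
  qed simp
  thus "0 < gauss_weight n e" "gauss_weight n e \<le> 1"
    using assms by (auto simp: gauss_weight_def pochhammer_pos divide_le_eq_1)
qed

lemma gauss_weight_tendsto: "(gauss_weight n \<longlongrightarrow> 1) (at_right 0)"
proof -
  have "((\<lambda>e::real. pochhammer (1 + e) n) \<longlongrightarrow> pochhammer (1 + 0) n) (at_right 0)"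
    unfolding pochhammer_prod by (intro tendsto_intros)
  hence "((\<lambda>e. fact n / pochhammer (1 + e :: real) n) \<longlongrightarrow> fact n / fact n) (at_right 0)"
    by (intro tendsto_intros) (simp_all add: pochhammer_fact[symmetric])
  thus ?thesis by (simp add: gauss_weight_def[abs_def])
qed

text \<open>A regularized harmonic series. It is Gauss's sum for parameters 1, 1, 2+e divided by
  1+e, which turns (2+e,n) into (1+e,n+1); the entry at n = 0 is 0 by convention.\<close>

lemma sums_harmonic_gauss_weight:
  assumes "e > 0"
  shows "(\<lambda>n. gauss_weight n e / n) sums (1 / e)"
proof -
  have B: "Beta 1 e = 1 / e" "Beta 1 (1 + e) = 1 / (1 + e)"
    using assms Gamma_plus1[of e] Gamma_plus1[of "1 + e"]
    by (auto simp: Beta_def nonpos_Ints_def Gamma_eq_zero_iff add_ac)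
  have "(\<lambda>n. pochhammer 1 n * pochhammer 1 n / (pochhammer (2 + e) n * fact n)) sums ((1 / e) / (1 / (1 + e)))"
    using gauss_summation[of 1 1 "2 + e"] assms B by simp
  hence "(\<lambda>n. 1 / (1 + e) * (pochhammer 1 n * pochhammer 1 n / (pochhammer (2 + e) n * fact n)))
    sums (1 / (1 + e) * ((1 / e) / (1 / (1 + e))))"
    by (rule sums_mult)
  moreover have "1 / (1 + e) * (pochhammer 1 n * pochhammer 1 n / (pochhammer (2 + e) n * fact n)) =
      gauss_weight (Suc n) e / Suc n" for n
    by (simp add: gauss_weight_def pochhammer_rec pochhammer_fact[symmetric] add_ac del: of_nat_Suc)
  moreover have "1 / (1 + e) * ((1 / e) / (1 / (1 + e))) = 1 / e" using assms by simp
  ultimately have "(\<lambda>n. gauss_weight (Suc n) e / Suc n) sums (1 / e)" by (simp only:)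
  thus ?thesis by (subst (asm) sums_Suc_iff) simp
qed

text \<open>Perturbing the third parameter from \<open>1\<close> to \<open>1 + e\<close> makes the series at \<open>1\<close> converge, and its
  divergent part is \<open>\<kappa>/e\<close> with \<open>\<kappa> = sin(\<pi>a)/\<pi>\<close>; the constant is the derivative at \<open>e = 0\<close> of \<open>e\<close> times Gauss' value.\<close>

theorem hyp_log_const_eq:
  assumes a: "0 < a" "a < 1"
  shows "hyp_log_const a = reflection_const a * ramanujan_R a"
proof -
  \<comment> \<open>Chosen so that G(e)/e is Gauss's value for parameters a, 1-a, 1+e, and G(0) =
    \<kappa>.\<close>
  define G where "G e = (Gamma (1 + e))\<^sup>2 * (rGamma (a + e) * rGamma (1 - a + e))" for e
  let ?S = "\<lambda>e. - (\<Sum>n. hyp_defect a n * gauss_weight n e)"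
  have G0: "G 0 = reflection_const a"
    using reflection_const_eq[OF a] by (simp add: G_def)
  have S: "?S e = (G e - G 0) / e" if e: "e > 0" for e
  proof -
    have "Beta (1 - a) e / Beta (1 - a) (a + e) = G e / e"
      using a e Gamma_plus1[of e]
      by (auto simp: Beta_def G_def rGamma_inverse_Gamma nonpos_Ints_def Gamma_eq_zero_iff add_ac
           power2_eq_square divide_simps)
    hence "(\<lambda>n. pochhammer a n * pochhammer (1 - a) n / (pochhammer (1 + e) n * fact n)) sums (G e / e)"
      using gauss_summation[of a "1 - a" "1 + e"] a e by (simp add: algebra_simps)
    hence "(\<lambda>n. hyp_coeff a n * gauss_weight n e) sums (G e / e)"
      by (simp add: hyp_coeff_def gauss_weight_def power2_eq_square mult.commute)
    \<comment> \<open>Subtracting \<kappa> times the regularized harmonic series removes the pole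
      G(0)/e and leaves a difference quotient of G.\<close>
    from sums_diff[OF this sums_mult[OF sums_harmonic_gauss_weight[OF e], of "reflection_const a"]]
    have "(\<lambda>n. - (hyp_defect a n * gauss_weight n e)) sums ((G e - G 0) / e)"
      by (simp add: hyp_defect_def G0 algebra_simps diff_divide_distrib)
    thus ?thesis using sums_minus sums_unique by fastforce
  qed
  have "((\<lambda>e. \<Sum>n. hyp_defect a n * gauss_weight n e) \<longlongrightarrow> suminf (hyp_defect a)) (at_right 0)"
  proof (rule tannery_uniform[OF _ _ summable_hyp_defect[OF a]])
    show "((\<lambda>e. hyp_defect a n * gauss_weight n e) \<longlongrightarrow> hyp_defect a n) (at_right 0)" for n
      using tendsto_mult[OF tendsto_const[of "hyp_defect a n"] gauss_weight_tendsto] by simp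
    show "eventually (\<lambda>e. \<forall>n. \<bar>hyp_defect a n * gauss_weight n e\<bar> \<le> \<bar>hyp_defect a n\<bar>) (at_right 0)"
      using eventually_at_right_less[of 0]
    proof eventually_elim
      case (elim e)
      show ?case using gauss_weight_bounds[OF elim] by (auto simp: abs_mult mult_left_le abs_of_pos)
    qed
  qed simp
  hence "(?S \<longlongrightarrow> hyp_log_const a) (at_right 0)"
    unfolding hyp_log_const_def by (intro tendsto_minus)
  moreover have "eventually (\<lambda>e. ?S e = (G e - G 0) / e) (at_right 0)"
    using eventually_at_right_less[of 0] by eventually_elim (rule S)
  ultimately have "((\<lambda>e. (G e - G 0) / e) \<longlongrightarrow> hyp_log_const a) (at_right 0)"
    by (rule Lim_transform_eventually)
  \<comment> \<open>The logarithmic derivative of G at 0 is 2\<Psi>(1) - \<Psi>(a) - \<Psi>(1-a),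
    and \<Psi>(1) = -\<gamma>.\<close>
  moreover have "(G has_real_derivative reflection_const a * ramanujan_R a) (at 0)"
  proof -
    have D: "((\<lambda>e. rGamma (z + e)) has_real_derivative - rGamma z * Digamma z) (at 0)" if "z > 0" for z
    proof -
      have "z \<notin> \<int>\<^sub>\<le>\<^sub>0" using that by (auto dest: nonpos_Ints_nonpos)
      hence "(rGamma has_real_derivative - rGamma z * Digamma z) (at (0 + z))"
        using has_field_derivative_rGamma_no_nonpos_int[of z] by simp
      thus ?thesis by (subst (asm) DERIV_shift) (simp add: add.commute)
    qed
    have "(Gamma has_real_derivative Gamma 1 * Digamma 1) (at (0 + 1))"
      using has_field_derivative_Gamma[of "1::real" UNIV] by simp
    hence "((\<lambda>e::real. Gamma (1 + e)) has_real_derivative - euler_mascheroni) (at 0)"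
      by (subst (asm) DERIV_shift) (simp add: add.commute)
    hence "(G has_real_derivative
        (2 * Gamma (1 + 0) * (- euler_mascheroni)) * (rGamma (a + 0) * rGamma (1 - a + 0)) +
        (- rGamma a * Digamma a * rGamma (1 - a + 0)
          + - rGamma (1 - a) * Digamma (1 - a) * rGamma (a + 0)) * (Gamma (1 + 0))\<^sup>2) (at 0)"
      unfolding G_def[abs_def] using a
      by (intro DERIV_mult DERIV_power[where n = 2, THEN DERIV_cong] D) auto
    thus ?thesis
      by (rule DERIV_cong) (simp add: reflection_const_eq[OF a] ramanujan_R_def algebra_simps)
  qed
  hence "((\<lambda>e. (G e - G 0) / e) \<longlongrightarrow> reflection_const a * ramanujan_R a) (at_right 0)"
    by (auto simp: has_field_derivative_iff intro: tendsto_mono[OF at_le])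
  ultimately show ?thesis
    by (rule tendsto_unique[OF trivial_limit_at_right_real])
qed

text \<open>Gauss's multiplication formula for \<Psi> with three terms: the reciprocals of k+1/3,
  k+2/3 and k+1 interlace to three times a harmonic sum of length 3n, so \<Psi>(1/3) + \<Psi>(2/3) +
  \<Psi>(1) = -3\<gamma> - 3 ln 3.\<close>

lemma ramanujan_R_third: "ramanujan_R (1/3) = ln 27"
proof -
  have harm_split: "(\<Sum>k<n. inverse (1/3 + real k)) + (\<Sum>k<n. inverse (2/3 + real k)) + (\<Sum>k<n. inverse (1 + real k))
     = 3 * harm (3 * n)" for n
  proof (induction n)
    case (Suc n)
    have "harm (3 * Suc n) = harm (3 * n) + inverse (3 * real n + 1) + inverse (3 * real n + 2) + inverse (3 * real n + 3)"
      by (simp add: harm_Suc eval_nat_numeral add_ac)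
    moreover have "inverse (1/3 + real n) = 3 * inverse (3 * real n + 1)"
      "inverse (2/3 + real n) = 3 * inverse (3 * real n + 2)"
      "inverse (1 + real n) = 3 * inverse (3 * real n + 3)"
      by (simp_all add: divide_simps)
    ultimately show ?case using Suc by simp
  qed (simp add: harm_def)
  have "(\<lambda>m. (ln (real m) - (\<Sum>n<m. inverse (1/3 + real n))) + (ln (real m) - (\<Sum>n<m. inverse (2/3 + real n)))
          + (ln (real m) - (\<Sum>n<m. inverse (1 + real n)))) \<longlonglongrightarrow> Digamma (1/3) + Digamma (2/3) + Digamma 1"
    using Digamma_LIMSEQ[of "1/3::real"] Digamma_LIMSEQ[of "2/3::real"] Digamma_LIMSEQ[of "1::real"]
    by (intro tendsto_add) simp_all
  moreover have "eventually (\<lambda>m. (ln (real m) - (\<Sum>n<m. inverse (1/3 + real n))) + (ln (real m) - (\<Sum>n<m. inverse (2/3 + real n)))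
          + (ln (real m) - (\<Sum>n<m. inverse (1 + real n))) = - 3 * (harm (3 * m) - ln (real (3 * m))) - 3 * ln 3) sequentially"
    using eventually_gt_at_top[of 0]
  proof eventually_elim
    case (elim m)
    thus ?case using harm_split[of m] by (simp add: ln_mult)
  qed
  ultimately have "(\<lambda>m. - 3 * (harm (3 * m) - ln (real (3 * m))) - 3 * ln 3) \<longlonglongrightarrow> Digamma (1/3) + Digamma (2/3) + Digamma (1::real)"
    by (rule Lim_transform_eventually)
  moreover have "(\<lambda>m. - 3 * (harm (3 * m) - ln (real (3 * m))) - 3 * ln 3) \<longlonglongrightarrow> - 3 * euler_mascheroni - 3 * ln (3::real)"
    using LIMSEQ_subseq_LIMSEQ[OF euler_mascheroni_LIMSEQ, of "\<lambda>m. 3 * m"]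
    by (intro tendsto_intros) (auto simp: strict_mono_def o_def)
  ultimately have "Digamma (1/3) + Digamma (2/3) + Digamma (1::real) = - 3 * euler_mascheroni - 3 * ln 3"
    by (rule LIMSEQ_unique)
  moreover have "ln (27::real) = 3 * ln 3"
    using ln_realpow[of 3 3] by simp
  ultimately show ?thesis by (simp add: ramanujan_R_def)
qed

section \<open>Monotonicity of the generalized modulus in the parameter\<close>

lemma filterlim_one_minus:
  "filterlim (\<lambda>t::real. 1 - t) (at_left 1) (at_right 0)"
  "filterlim (\<lambda>t::real. 1 - t) (at_right 0) (at_left 1)"
  by (auto simp: filterlim_at eventually_at_filter intro!: tendsto_eq_intros)

lemma eventually_at_right_unit_interval: "eventually (\<lambda>t::real. t \<in> {0<..<1}) (at_right 0)"
  by (rule eventually_at_right_real) simp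

lemma tendsto_mult_ln_0: "((\<lambda>t::real. t * ln t) \<longlongrightarrow> 0) (at_right 0)"
proof -
  have "((\<lambda>x::real. ln x / x) \<longlongrightarrow> 0) at_top"
    by (rule ln_x_over_x_tendsto_0)
  hence "((\<lambda>t::real. ln (inverse t) / inverse t) \<longlongrightarrow> 0) (at_right 0)"
    by (rule filterlim_compose) (rule filterlim_inverse_at_top_right)
  hence "((\<lambda>t::real. - (ln (inverse t) / inverse t)) \<longlongrightarrow> - 0) (at_right 0)"
    by (rule tendsto_minus)
  moreover have "eventually (\<lambda>t::real. - (ln (inverse t) / inverse t) = t * ln t) (at_right 0)"
    using eventually_at_right_less[of 0] by eventually_elim (simp add: ln_inverse divide_inverse)
  ultimately show ?thesis using Lim_transform_eventually by fastforce
qed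

section \<open>The modulus in the squared variable: derivative and limits at both ends\<close>

text \<open>The function m_a of the outline: \<open>t\<close> stands for the square of the argument
  of \<open>mu\<close>, and \<pi>/(2 sin(\<pi>a)) is 1/(2\<kappa>).\<close>

definition hyp_ratio :: "real \<Rightarrow> real \<Rightarrow> real" where
  "hyp_ratio a t = hyp a (1 - t) / hyp a t / (2 * reflection_const a)"

context
  fixes a :: real
  assumes a: "0 < a" "a < 1"
begin

lemma hyp_log_asymptotic_at_0:
  "((\<lambda>t. hyp a (1 - t) + reflection_const a * ln t) \<longlongrightarrow> reflection_const a * ramanujan_R a) (at_right 0)"
  using filterlim_compose[OF hyp_log_asymptotic[OF a] filterlim_one_minus(1)]
  by (simp add: hyp_log_const_eq[OF a])

lemma hyp_tendsto_0: "(hyp a \<longlongrightarrow> 1) (at_right 0)"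
  using isCont_hyp[OF a, of 0] hyp_0[OF a] by (auto simp: isCont_def intro: tendsto_mono[OF at_le])

lemma has_field_derivative_hyp_reflected:
  assumes "0 < t" "t < 1"
  shows "((\<lambda>t. hyp a (1 - t)) has_real_derivative - (hyp_flux a (1 - t) / (t * (1 - t)))) (at t)"
proof -
  have "((\<lambda>t. hyp a (1 - t)) has_real_derivative
      hyp_flux a (1 - t) / ((1 - t) * (1 - (1 - t))) * (0 - 1)) (at t)"
    using assms by (intro DERIV_chain2[OF has_field_derivative_hyp[OF a]] derivative_intros) auto
  thus ?thesis by (simp add: mult.commute)
qed

text \<open>Differentiating, the contributions of the self-adjoint equation and of F' cancel in
  pairs, so the expression is constant; its value is its limit at 0.\<close>

lemma hyp_wronskian:
  assumes t: "0 < t" "t < 1"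
  shows "hyp_flux a t * hyp a (1 - t) + hyp a t * hyp_flux a (1 - t) = reflection_const a"
proof -
  define W where "W t = hyp_flux a t * hyp a (1 - t) + hyp a t * hyp_flux a (1 - t)" for t
  have W_deriv: "(W has_real_derivative 0) (at x)" if "0 < x" "x < 1" for x
  proof -
    have P: "((\<lambda>t. hyp_flux a (1 - t)) has_real_derivative a * (1 - a) * hyp a (1 - x) * (0 - 1)) (at x)"
      using that by (intro DERIV_chain2[OF has_field_derivative_hyp_flux[OF a]] derivative_intros) auto
    show ?thesis
      unfolding W_def[abs_def] using that
      by (auto intro!: derivative_eq_intros has_field_derivative_hyp_reflected P has_field_derivative_hyp[OF a] has_field_derivative_hyp_flux[OF a]
          simp: algebra_simps)
  qed
  have "W t = W x" if "0 < x" "x < 1" for x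
    by (rule DERIV_isconst3[of 0 1]) (use W_deriv t that in auto)
  hence "eventually (\<lambda>x. W x = W t) (at_right 0)"
    using eventually_at_right_unit_interval by (auto elim!: eventually_mono)
  hence 1: "(W \<longlongrightarrow> W t) (at_right 0)"
    by (simp add: tendsto_eventually)
  \<comment> \<open>Near 0 the flux is O(x) and F(1-x) grows only logarithmically, so the first
    product vanishes; the second tends to 1 times \<kappa>.\<close>
  have "((\<lambda>x. (hyp_flux a x / x) * (x * (hyp a (1 - x) + reflection_const a * ln x) - reflection_const a * (x * ln x))
          + hyp a x * hyp_flux a (1 - x)) \<longlongrightarrow>
      a * (1 - a) * (0 * (reflection_const a * ramanujan_R a) - reflection_const a * 0) + 1 * reflection_const a) (at_right 0)"
  proof (intro tendsto_intros hyp_log_asymptotic_at_0 tendsto_mult_ln_0 hyp_tendsto_0)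
    have "((\<lambda>x. (hyp_flux a x - hyp_flux a 0) / (x - 0)) \<longlongrightarrow> a * (1 - a) * hyp a 0) (at 0)"
      using has_field_derivative_hyp_flux[OF a, of 0] by (simp add: has_field_derivative_iff)
    thus "((\<lambda>x. hyp_flux a x / x) \<longlongrightarrow> a * (1 - a)) (at_right 0)"
      by (auto simp: hyp_flux_0[OF a] hyp_0[OF a] intro: tendsto_mono[OF at_le])
    show "((\<lambda>x. hyp_flux a (1 - x)) \<longlongrightarrow> reflection_const a) (at_right 0)"
      using filterlim_compose[OF hyp_flux_tendsto[OF a] filterlim_one_minus(1)] .
  qed
  moreover have "eventually (\<lambda>x. (hyp_flux a x / x) * (x * (hyp a (1 - x) + reflection_const a * ln x) - reflection_const a * (x * ln x))
          + hyp a x * hyp_flux a (1 - x) = W x) (at_right 0)"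
    using eventually_at_right_less[of 0] by eventually_elim (simp add: W_def algebra_simps)
  ultimately have "(W \<longlongrightarrow> reflection_const a) (at_right 0)"
    using Lim_transform_eventually by fastforce
  from tendsto_unique[OF trivial_limit_at_right_real 1 this] show ?thesis
    by (simp add: W_def)
qed

text \<open>The numerator of the quotient rule is the Wronskian expression up to sign and the factor
  t(1-t), so \<kappa> cancels.\<close>

lemma has_field_derivative_hyp_ratio:
  assumes t: "0 < t" "t < 1"
  shows "(hyp_ratio a has_real_derivative - 1 / (2 * t * (1 - t) * (hyp a t)\<^sup>2)) (at t)"
proof -
  have pos: "hyp a t > 0" "reflection_const a > 0"
    using hyp_ge_1[OF a, of t] t reflection_const_pos[OF a] by auto
  have "(hyp_ratio a has_real_derivative
     (- (hyp_flux a (1 - t) / (t * (1 - t))) * hyp a t - hyp a (1 - t) * (hyp_flux a t / (t * (1 - t))))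
       / (hyp a t * hyp a t) / (2 * reflection_const a)) (at t)"
    unfolding hyp_ratio_def[abs_def] using pos
    by (intro DERIV_cdivide DERIV_divide has_field_derivative_hyp_reflected has_field_derivative_hyp[OF a] t) auto
  also have "- (hyp_flux a (1 - t) / (t * (1 - t))) * hyp a t - hyp a (1 - t) * (hyp_flux a t / (t * (1 - t)))
      = - (hyp_flux a t * hyp a (1 - t) + hyp a t * hyp_flux a (1 - t)) / (t * (1 - t))"
    using t by (simp add: diff_divide_distrib add_divide_distrib mult_ac)
  also have "\<dots> / (hyp a t * hyp a t) / (2 * reflection_const a) = - 1 / (2 * t * (1 - t) * (hyp a t)\<^sup>2)"
    unfolding hyp_wronskian[OF t] using pos t by (simp add: power2_eq_square)
  finally show ?thesis .
qed

text \<open>Pair the logarithm with F(1-t) first; what remains is (1 - 1/F(t)) ln t / 2, which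
  vanishes because F(t) - 1 = O(t).\<close>

lemma hyp_ratio_at_0: "((\<lambda>t. hyp_ratio a t + ln t / 2) \<longlongrightarrow> ramanujan_R a / 2) (at_right 0)"
proof -
  have k: "reflection_const a > 0" by (rule reflection_const_pos[OF a])
  have "((\<lambda>t. (hyp a (1 - t) + reflection_const a * ln t) / hyp a t / (2 * reflection_const a)
          + (hyp a t - 1) / t * (t * ln t) / hyp a t / 2) \<longlongrightarrow>
     reflection_const a * ramanujan_R a / 1 / (2 * reflection_const a) + hyp_deriv a 0 * 0 / 1 / 2) (at_right 0)"
  proof (intro tendsto_intros hyp_log_asymptotic_at_0 tendsto_mult_ln_0 hyp_tendsto_0)
    have "((\<lambda>x. (hyp a x - hyp a 0) / (x - 0)) \<longlongrightarrow> hyp_deriv a 0) (at 0)"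
      using has_field_derivative_hyp_aux[OF a, of 0] by (simp add: has_field_derivative_iff)
    thus "((\<lambda>x. (hyp a x - 1) / x) \<longlongrightarrow> hyp_deriv a 0) (at_right 0)"
      by (auto simp: hyp_0[OF a] intro: tendsto_mono[OF at_le])
  qed (use k in auto)
  moreover have "eventually (\<lambda>t. (hyp a (1 - t) + reflection_const a * ln t) / hyp a t / (2 * reflection_const a)
          + (hyp a t - 1) / t * (t * ln t) / hyp a t / 2 = hyp_ratio a t + ln t / 2) (at_right 0)"
    using eventually_at_right_unit_interval
  proof eventually_elim
    case (elim t)
    hence "hyp a t \<noteq> 0" "t \<noteq> 0" using hyp_ge_1[OF a, of t] by auto
    thus ?case using k unfolding hyp_ratio_def by (simp add: divide_simps) (simp add: algebra_simps)
  qed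
  ultimately show ?thesis using k Lim_transform_eventually by fastforce
qed

text \<open>The denominator F(t) diverges logarithmically while F(1-t) tends to 1.\<close>

lemma hyp_ratio_at_1: "(hyp_ratio a \<longlongrightarrow> 0) (at_left 1)"
proof -
  have k: "reflection_const a > 0" by (rule reflection_const_pos[OF a])
  have "filterlim (\<lambda>t::real. ln (1 - t)) at_bot (at_left 1)"
    by (rule filterlim_compose[OF ln_at_0 filterlim_one_minus(2)])
  hence "filterlim (\<lambda>t. reflection_const a * - ln (1 - t)) at_top (at_left 1)"
    using k by (intro filterlim_tendsto_pos_mult_at_top[OF tendsto_const]) (auto simp: filterlim_uminus_at_top)
  from filterlim_tendsto_add_at_top[OF hyp_log_asymptotic[OF a] this]
  have "filterlim (hyp a) at_infinity (at_left 1)"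
    by (intro filterlim_at_top_imp_at_infinity) simp
  from tendsto_divide_0[OF filterlim_compose[OF hyp_tendsto_0 filterlim_one_minus(2)] this]
  have "((\<lambda>t. hyp a (1 - t) / hyp a t / (2 * reflection_const a)) \<longlongrightarrow> 0 / (2 * reflection_const a)) (at_left 1)"
    using k by (intro tendsto_intros) auto
  thus ?thesis by (simp add: hyp_ratio_def[abs_def])
qed

end

section \<open>Comparison of two parameters\<close>

text \<open>On (0,1/2] the product a(1-a) increases, hence so does every coefficient; the linear
  one, equal to a(1-a), makes the inequality strict.\<close>

lemma hyp_strict_mono:
  assumes ab: "0 < a" "a < b" "b \<le> 1/2" and x: "0 < x" "x < 1"
  shows "hyp a x < hyp b x"
proof -
  have ab': "a < 1" "0 < b" "b < 1" using ab by auto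
  have p: "a * (1 - a) < b * (1 - b)"
  proof -
    have "0 < (b - a) * (1 - a - b)" using ab by (intro mult_pos_pos) auto
    thus ?thesis by (simp add: algebra_simps)
  qed
  have le: "hyp_coeff a n \<le> hyp_coeff b n" for n
  proof (induction n)
    case (Suc n)
    show ?case unfolding hyp_coeff_Suc
      using Suc p parameter_product(1)[of a] hyp_coeff_pos[of b n] ab ab'
      by (intro divide_right_mono mult_mono) (auto intro: less_imp_le)
  qed simp
  have sums: "(\<lambda>n. hyp_coeff b n * x ^ n - hyp_coeff a n * x ^ n) sums (hyp b x - hyp a x)"
    unfolding hyp_eq using ab ab' x by (intro sums_diff summable_sums summable_hyp) auto
  have "0 < (b * (1 - b) - a * (1 - a)) * x" using p x by simp
  also have "\<dots> = (\<Sum>n\<in>{1}. hyp_coeff b n * x ^ n - hyp_coeff a n * x ^ n)"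
    by (simp add: hyp_coeff_def algebra_simps)
  also have "\<dots> \<le> (\<Sum>n. hyp_coeff b n * x ^ n - hyp_coeff a n * x ^ n)"
    using le x by (intro sum_le_suminf sums_summable[OF sums]) (auto intro: mult_right_mono)
  also have "\<dots> = hyp b x - hyp a x" using sums by (simp add: sums_iff)
  finally show ?thesis by simp
qed

theorem hyp_ratio_diff_bounds:
  assumes ab: "0 < a" "a < b" "b \<le> 1/2" and t: "0 < t" "t < 1"
  shows "hyp_ratio b t < hyp_ratio a t"
    and "hyp_ratio a t - hyp_ratio b t < (ramanujan_R a - ramanujan_R b) / 2"
proof -
  have a: "0 < a" "a < 1" and b: "0 < b" "b < 1" using ab by auto
  define h where "h t = hyp_ratio a t - hyp_ratio b t" for t
  have h_deriv: "\<exists>y. (h has_real_derivative y) (at x) \<and> y < 0" if x: "0 < x" "x < 1" for x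
  proof (intro exI conjI)
    show "(h has_real_derivative - 1 / (2 * x * (1 - x) * (hyp a x)\<^sup>2) - - 1 / (2 * x * (1 - x) * (hyp b x)\<^sup>2)) (at x)"
      unfolding h_def[abs_def] by (intro DERIV_diff has_field_derivative_hyp_ratio a b x)
    have "(hyp a x)\<^sup>2 < (hyp b x)\<^sup>2"
      using hyp_strict_mono[OF ab x] hyp_ge_1[OF a, of x] x by (intro power_strict_mono) auto
    hence "1 / (2 * x * (1 - x) * (hyp b x)\<^sup>2) < 1 / (2 * x * (1 - x) * (hyp a x)\<^sup>2)"
      using x hyp_ge_1[OF a, of x] by (intro divide_strict_left_mono mult_strict_left_mono mult_pos_pos) auto
    thus "- 1 / (2 * x * (1 - x) * (hyp a x)\<^sup>2) - - 1 / (2 * x * (1 - x) * (hyp b x)\<^sup>2) < 0"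
      by simp
  qed
  have decr: "h y < h x" if "0 < x" "x < y" "y < 1" for x y
    using that by (intro DERIV_neg_imp_decreasing[of x y h] h_deriv) auto
  have "((\<lambda>t. (hyp_ratio a t + ln t / 2) - (hyp_ratio b t + ln t / 2)) \<longlongrightarrow> ramanujan_R a / 2 - ramanujan_R b / 2) (at_right 0)"
    by (intro tendsto_diff hyp_ratio_at_0 a b)
  hence h0: "(h \<longlongrightarrow> (ramanujan_R a - ramanujan_R b) / 2) (at_right 0)"
    by (simp add: h_def[abs_def] diff_divide_distrib)
  have "((\<lambda>t. hyp_ratio a t - hyp_ratio b t) \<longlongrightarrow> 0 - 0) (at_left 1)"
    by (intro tendsto_diff hyp_ratio_at_1 a b)
  hence h1: "(h \<longlongrightarrow> 0) (at_left 1)" by (simp add: h_def[abs_def])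
  \<comment> \<open>A limit yields only a weak bound, so it is taken at an intermediate point; the
    strict decrease of \<open>h\<close> from there to \<open>t\<close> gives strictness. The other
    end is treated alike.\<close>
  have "h (t / 2) \<le> (ramanujan_R a - ramanujan_R b) / 2"
  proof (rule tendsto_lowerbound[OF h0])
    show "eventually (\<lambda>x. h (t / 2) \<le> h x) (at_right 0)"
      using eventually_at_right_real[of 0 "t / 2"] t decr[of _ "t / 2"]
      by (auto elim!: eventually_mono intro: less_imp_le)
  qed simp
  with decr[of "t / 2" t] t show "hyp_ratio a t - hyp_ratio b t < (ramanujan_R a - ramanujan_R b) / 2"
    by (simp add: h_def)
  have "h ((1 + t) / 2) \<ge> 0"
  proof (rule tendsto_upperbound[OF h1])
    show "eventually (\<lambda>x. h x \<le> h ((1 + t) / 2)) (at_left 1)"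
      using eventually_at_left_real[of "(1 + t) / 2" 1] t decr[of "(1 + t) / 2"]
      by (auto elim!: eventually_mono intro: less_imp_le)
  qed simp
  with decr[of t "(1 + t) / 2"] t show "hyp_ratio b t < hyp_ratio a t"
    by (simp add: h_def)
qed

section \<open>The cubic transformation\<close>

text \<open>The cube of the next iterate r_(n+1) as a function of x = r_n.\<close>

definition cubic_arg :: "real \<Rightarrow> real" where
  "cubic_arg x = 1 - ((1 - x) / (1 + 2 * x)) ^ 3"

lemma cubic_arg_range: "0 < x \<Longrightarrow> x < 1 \<Longrightarrow> 0 < cubic_arg x \<and> cubic_arg x < 1"
  using power_strict_mono[of "(1 - x) / (1 + 2 * x)" 1 3] by (auto simp: cubic_arg_def)

lemma cubic_arg_altdef:
  assumes "x \<ge> 0"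
  shows "cubic_arg x = 9 * x * (1 + x + x\<^sup>2) / (1 + 2 * x) ^ 3"
proof -
  have "1 + 2 * x \<noteq> 0" using assms by simp
  thus ?thesis unfolding cubic_arg_def power_divide
    by (simp add: divide_simps) (simp add: algebra_simps power2_eq_square power3_eq_cube)
qed

lemma has_field_derivative_cubic_arg:
  assumes "x \<ge> 0"
  shows "(cubic_arg has_real_derivative 9 * (1 - x)\<^sup>2 / (1 + 2 * x) ^ 4) (at x)"
proof -
  have nz: "1 + 2 * x \<noteq> 0" using assms by simp
  have "(cubic_arg has_real_derivative
      0 - 3 * ((1 - x) / (1 + 2 * x))\<^sup>2 * (((0 - 1) * (1 + 2 * x) - (1 - x) * (0 + 2 * 1)) / ((1 + 2 * x) * (1 + 2 * x)))) (at x)"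
    unfolding cubic_arg_def[abs_def] using nz
    by (auto intro!: derivative_eq_intros simp: power2_eq_square)
  also have "(0 - 1) * (1 + 2 * x) - (1 - x) * (0 + 2 * 1) = - 3" by simp
  finally show ?thesis
    by (rule DERIV_cong) (simp add: power_divide power2_eq_square power4_eq_xxxx)
qed

lemma one_third_bounds: "0 < (1/3 :: real)" "1/3 < (1 :: real)" by auto

text \<open>Both sides solve \<open>(Q y')' = q y\<close> with \<open>Q = x(1-x\<^sup>3)/(1+2x)\<^sup>2\<close> and the same \<open>q\<close>. Their
  Wronskian \<open>K = Q(uv' - u'v)\<close> is constant, and it vanishes since \<open>Q\<close> does at \<open>0\<close>. In the proof
  \<open>A = Qu'\<close> and \<open>B = Qv'\<close>, where \<open>v = (1+2x)w\<close>.\<close>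

theorem hyp_cubic_transformation:
  assumes x: "0 \<le> x" "x < 1"
  shows "hyp (1/3) (cubic_arg x) = (1 + 2 * x) * hyp (1/3) (x ^ 3)"
proof (cases "x = 0")
  case False
  define u where "u x = hyp (1/3) (cubic_arg x)" for x
  define w where "w x = hyp (1/3) (x ^ 3)" for x :: real
  define A where "A x = hyp_flux (1/3) (cubic_arg x)" for x
  define p where "p x = hyp_flux (1/3) (x ^ 3)" for x :: real
  define P where "P x = x * (1 - x ^ 3)" for x :: real
  \<comment> \<open>This is Qv' written out with Q = P/(1+2x)^2 and w' = 3p/P.\<close>
  define B where "B x = 3 * p x / (1 + 2 * x) + 2 * P x * w x / (1 + 2 * x)\<^sup>2" for x
  define K where "K x = u x * B x - (1 + 2 * x) * w x * A x" for x
  have cube: "0 < y ^ 3" "y ^ 3 < 1" if "0 < y" "y < 1" for y :: real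
    using that power_strict_mono[of y 1 3] by auto
  have P_pos: "P y > 0" if "0 < y" "y < 1" for y
    using cube[OF that] that by (simp add: P_def)
  have w_pos: "w y > 0" if "0 \<le> y" "y < 1" for y
  proof -
    have "y ^ 3 < 1" using that power_strict_mono[of y 1 3] by auto
    thus ?thesis using hyp_ge_1[OF one_third_bounds, of "y ^ 3"] that by (auto simp: w_def)
  qed
  \<comment> \<open>The derivative of \<open>cubic_arg\<close> factored so that the denominator of
    F' cancels in the chain rule, leaving u' = A/Q.\<close>
  have flux_ratio: "9 * (1 - y)\<^sup>2 / (1 + 2 * y) ^ 4 = cubic_arg y * (1 - cubic_arg y) * ((1 + 2 * y)\<^sup>2 / P y)"
    if y: "0 < y" "y < 1" for y
  proof -
    define d where "d = 1 + 2 * y"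
    have "P y = y * (1 - y) * (1 + y + y\<^sup>2)"
      by (simp add: P_def algebra_simps power2_eq_square power3_eq_cube)
    moreover have "1 + y + y\<^sup>2 > 0"
      using y by (simp add: add_pos_nonneg)
    hence "1 + y + y\<^sup>2 \<noteq> 0" by simp
    moreover have "y \<noteq> 0" "1 - y \<noteq> 0" "d \<noteq> 0"
      using y by (auto simp: d_def)
    moreover have "1 - cubic_arg y = (1 - y) ^ 3 / d ^ 3"
      by (simp add: cubic_arg_def power_divide d_def)
    moreover have "cubic_arg y = 9 * y * (1 + y + y\<^sup>2) / d ^ 3"
      using y cubic_arg_altdef[of y] by (simp add: d_def)
    ultimately show ?thesis
      unfolding d_def[symmetric] by (simp only:) (simp add: divide_simps eval_nat_numeral)
  qed
  have u': "(u has_real_derivative A y * (1 + 2 * y)\<^sup>2 / P y) (at y)" if y: "0 < y" "y < 1" for y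
  proof -
    have c: "0 < cubic_arg y" "cubic_arg y < 1" using cubic_arg_range[OF y] by auto
    have "(u has_real_derivative A y / (cubic_arg y * (1 - cubic_arg y)) * (9 * (1 - y)\<^sup>2 / (1 + 2 * y) ^ 4)) (at y)"
      unfolding u_def[abs_def] A_def using y c
      by (intro DERIV_chain2[OF has_field_derivative_hyp[OF one_third_bounds] has_field_derivative_cubic_arg]) auto
    thus ?thesis using c unfolding flux_ratio[OF y] by (simp add: mult.assoc)
  qed
  have A': "(A has_real_derivative 2 * (1 - y)\<^sup>2 / (1 + 2 * y) ^ 4 * u y) (at y)" if y: "0 < y" "y < 1" for y
  proof -
    have c: "0 < cubic_arg y" "cubic_arg y < 1" using cubic_arg_range[OF y] by auto
    have "(A has_real_derivative 1/3 * (1 - 1/3) * u y * (9 * (1 - y)\<^sup>2 / (1 + 2 * y) ^ 4)) (at y)"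
      unfolding A_def[abs_def] u_def using y c
      by (intro DERIV_chain2[OF has_field_derivative_hyp_flux[OF one_third_bounds] has_field_derivative_cubic_arg]) auto
    thus ?thesis by (rule DERIV_cong) simp
  qed
  have w': "(w has_real_derivative 3 * p y / P y) (at y)" if y: "0 < y" "y < 1" for y
  proof -
    have "(w has_real_derivative p y / (y ^ 3 * (1 - y ^ 3)) * (3 * y\<^sup>2)) (at y)"
      unfolding w_def[abs_def] p_def using cube[OF y] y
      by (intro DERIV_chain2[OF has_field_derivative_hyp[OF one_third_bounds]]) (auto intro!: derivative_eq_intros simp: power2_eq_square)
    thus ?thesis
      by (rule DERIV_cong) (use y in \<open>simp add: P_def power2_eq_square power3_eq_cube\<close>)
  qed
  have p': "(p has_real_derivative 2/3 * y\<^sup>2 * w y) (at y)" if y: "0 < y" "y < 1" for y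
  proof -
    have "(p has_real_derivative 1/3 * (1 - 1/3) * w y * (3 * y\<^sup>2)) (at y)"
      unfolding w_def p_def[abs_def] using cube[OF y] y
      by (intro DERIV_chain2[OF has_field_derivative_hyp_flux[OF one_third_bounds]]) (auto intro!: derivative_eq_intros simp: power2_eq_square)
    thus ?thesis by (rule DERIV_cong) simp
  qed
  have P': "(P has_real_derivative 1 - 4 * y ^ 3) (at y)" for y
    unfolding P_def[abs_def] by (auto intro!: derivative_eq_intros simp: power2_eq_square power3_eq_cube algebra_simps)
  \<comment> \<open>With q = 2(1-y)^2/(1+2y)^4 this reads B' = qv, matching A' = qu: both functions
    solve the same equation.\<close>
  have B': "(B has_real_derivative 2 * (1 - y)\<^sup>2 / (1 + 2 * y) ^ 3 * w y) (at y)" if y: "0 < y" "y < 1" for y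
  proof -
    define d where "d = 1 + 2 * y"
    have d: "d > 0" using y by (simp add: d_def)
    have "(B has_real_derivative
       (3 * (2/3 * y\<^sup>2 * w y) * d - 3 * p y * 2) / (d * d)
       + ((2 * (1 - 4 * y ^ 3) * w y + (3 * p y / P y) * (2 * P y)) * d\<^sup>2 - 2 * P y * w y * (2 * d * 2)) / (d\<^sup>2 * d\<^sup>2)) (at y)"
      unfolding B_def[abs_def] d_def using y d
      by (auto intro!: derivative_eq_intros p' w' P' simp: d_def)
    also have "(2 * (1 - 4 * y ^ 3) * w y + (3 * p y / P y) * (2 * P y)) = 2 * (1 - 4 * y ^ 3) * w y + 6 * p y"
      using P_pos[OF y] by simp
    also have "(3 * (2/3 * y\<^sup>2 * w y) * d - 3 * p y * 2) / (d * d)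
       + ((2 * (1 - 4 * y ^ 3) * w y + 6 * p y) * d\<^sup>2 - 2 * P y * w y * (2 * d * 2)) / (d\<^sup>2 * d\<^sup>2)
       = w y * (2 * y\<^sup>2 * d\<^sup>2 + 2 * (1 - 4 * y ^ 3) * d - 8 * P y) / d ^ 3"
      using d by (simp add: divide_simps) (simp add: algebra_simps eval_nat_numeral)
    also have "2 * y\<^sup>2 * d\<^sup>2 + 2 * (1 - 4 * y ^ 3) * d - 8 * P y = 2 * (1 - y)\<^sup>2"
      by (simp add: d_def P_def algebra_simps eval_nat_numeral)
    finally show ?thesis by (simp add: d_def mult_ac)
  qed
  have K': "(K has_real_derivative 0) (at y)" if y: "0 < y" "y < 1" for y
  proof -
    define d where "d = 1 + 2 * y"
    have d: "d > 0" using y by (simp add: d_def)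
    have "(K has_real_derivative
      (A y * d\<^sup>2 / P y * B y + 2 * (1 - y)\<^sup>2 / d ^ 3 * w y * u y)
       - ((2 * w y + 3 * p y / P y * d) * A y + 2 * (1 - y)\<^sup>2 / d ^ 4 * u y * (d * w y))) (at y)"
      unfolding K_def[abs_def] d_def
      by (auto intro!: derivative_eq_intros u' A' w' B' y)
    also have "(A y * d\<^sup>2 / P y * B y + 2 * (1 - y)\<^sup>2 / d ^ 3 * w y * u y)
       - ((2 * w y + 3 * p y / P y * d) * A y + 2 * (1 - y)\<^sup>2 / d ^ 4 * u y * (d * w y)) = 0"
      using d P_pos[OF y] unfolding B_def d_def[symmetric]
      by (simp add: divide_simps) (simp add: algebra_simps eval_nat_numeral)
    finally show ?thesis .
  qed
  \<comment> \<open>The derivatives above are available only for positive arguments, since P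
    vanishes at 0; continuity carries constancy to the endpoint.\<close>
  have cont: "continuous_on {0..y} K" "continuous_on {0..y} u" "continuous_on {0..y} w" if y: "y < 1" for y
  proof -
    have c: "cubic_arg ` {0..y} \<subseteq> {-1<..<1}" "(\<lambda>z. z ^ 3) ` {0..y} \<subseteq> {-1<..<1}"
    proof -
      have "-1 < z ^ 3 \<and> z ^ 3 < 1" if "z \<in> {0..y}" for z
      proof -
        have "0 \<le> z ^ 3" using that by simp
        moreover have "z ^ 3 < 1" using that y power_strict_mono[of z 1 3] by auto
        ultimately show ?thesis by linarith
      qed
      thus "(\<lambda>z. z ^ 3) ` {0..y} \<subseteq> {-1<..<1}" by auto
      have "-1 < cubic_arg z \<and> cubic_arg z < 1" if "z \<in> {0..y}" for z
        using cubic_arg_range[of z] that y by (cases "z = 0") (auto simp: cubic_arg_def)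
      thus "cubic_arg ` {0..y} \<subseteq> {-1<..<1}" by auto
    qed
    have H: "continuous_on {-1<..<1} (hyp (1/3))" "continuous_on {-1<..<1} (hyp_flux (1/3))"
      by (intro continuous_at_imp_continuous_on ballI isCont_hyp[OF one_third_bounds] isCont_hyp_flux[OF one_third_bounds]; auto)+
    have cube_cont: "continuous_on {0..y} (\<lambda>z. z ^ 3)" by (intro continuous_intros)
    have ca: "continuous_on {0..y} cubic_arg"
      by (rule DERIV_continuous_on) (auto intro: has_field_derivative_at_within has_field_derivative_cubic_arg)
    show 1: "continuous_on {0..y} u" "continuous_on {0..y} w"
      unfolding u_def[abs_def] w_def[abs_def]
      by (rule continuous_on_compose2[OF H(1) ca c(1)] continuous_on_compose2[OF H(1) cube_cont c(2)])+
    have "continuous_on {0..y} A" "continuous_on {0..y} p"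
      unfolding A_def[abs_def] p_def[abs_def]
      by (rule continuous_on_compose2[OF H(2) ca c(1)] continuous_on_compose2[OF H(2) cube_cont c(2)])+
    with 1 show "continuous_on {0..y} K"
      unfolding K_def[abs_def] B_def[abs_def] P_def[abs_def] by (auto intro!: continuous_intros)
  qed
  have zero: "u 0 = 1" "w 0 = 1" "A 0 = 0" "p 0 = 0"
    using hyp_0[OF one_third_bounds] hyp_flux_0[OF one_third_bounds] by (simp_all add: u_def w_def A_def p_def cubic_arg_def)
  have K0: "K y = 0" if "0 < y" "y < 1" for y
    using DERIV_isconst2[of 0 y K y] cont(1)[of y] K' that by (auto simp: K_def B_def P_def zero)
  \<comment> \<open>The derivative of u/v is a multiple of the Wronskian K, hence 0, and the
    quotient is 1 at 0.\<close>
  define q where "q x = u x / ((1 + 2 * x) * w x)" for x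
  have "q x = q 0"
  proof (rule DERIV_isconst2[of 0 x])
    show "(q has_real_derivative 0) (at y)" if y: "0 < y" "y < x" for y
    proof -
      have y1: "0 < y" "y < 1" using y x by auto
      define d where "d = 1 + 2 * y"
      have d: "d > 0" "w y > 0" using y1 w_pos[of y] by (auto simp: d_def)
      have "(q has_real_derivative
        ((A y * d\<^sup>2 / P y) * (d * w y) - u y * (2 * w y + 3 * p y / P y * d)) / ((d * w y) * (d * w y))) (at y)"
        unfolding q_def[abs_def] d_def using d
        by (auto intro!: derivative_eq_intros u' w' y1 simp: d_def)
      also have "(A y * d\<^sup>2 / P y) * (d * w y) - u y * (2 * w y + 3 * p y / P y * d) = - (d\<^sup>2 / P y) * K y"
        using d P_pos[OF y1] unfolding K_def B_def d_def[symmetric]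
        by (simp add: divide_simps) (simp add: algebra_simps eval_nat_numeral)
      finally show ?thesis using K0[OF y1] by simp
    qed
    show "continuous_on {0..x} q"
    proof -
      have "(1 + 2 * y) * w y \<noteq> 0" if "y \<in> {0..x}" for y
        using w_pos[of y] that x by auto
      thus ?thesis
        unfolding q_def[abs_def] by (intro continuous_intros cont[OF x(2)]) blast
    qed
  qed (use x False in auto)
  also have "q 0 = 1" using zero by (simp add: q_def)
  finally have "u x = (1 + 2 * x) * w x"
    using w_pos[OF x] x by (simp add: q_def divide_eq_eq split: if_splits)
  thus ?thesis by (simp only: u_def w_def)
qed (simp add: cubic_arg_def)

section \<open>The cubic iteration\<close>

lemma mu_eq_hyp_ratio:
  assumes "0 < r"
  shows "mu a (r powr (3/2)) = hyp_ratio a (r ^ 3)"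
proof -
  have "(r powr (3/2))\<^sup>2 = r ^ 3"
    using assms by (simp add: power2_eq_square flip: powr_add)
  thus ?thesis by (simp add: mu_def hyp_ratio_def reflection_const_def mult.commute)
qed

definition cubic_compl :: "real \<Rightarrow> nat \<Rightarrow> real" where
  "cubic_compl r n = 1 - cubic_seq r n ^ 3"

context
  fixes r :: real
  assumes r: "0 < r" "r < 1"
begin

lemma cubic_seq_pos: "cubic_seq r n > 0"
  and cubic_seq_less_1: "cubic_seq r n < 1"
  and cubic_seq_Suc_cube: "cubic_seq r (Suc n) ^ 3 = cubic_arg (cubic_seq r n)"
proof -
  have step: "(root 3 (9 * x * (1 + x + x\<^sup>2)) / (1 + 2 * x)) ^ 3 = cubic_arg x" if "0 < x" for x
    using that cubic_arg_altdef[of x] by (simp add: power_divide)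
  have less: "y < 1" if "y ^ 3 < (1::real)" for y
    by (rule ccontr) (use that one_le_power[of y 3] in linarith)
  have range: "0 < cubic_seq r n \<and> cubic_seq r n < 1" for n
  proof (induction n)
    case 0
    have "0 < r ^ 3" "r ^ 3 < 1"
      using r power_strict_mono[of r 1 3] by auto
    thus ?case using less[of "root 3 (1 - r ^ 3)"] by auto
  next
    case (Suc n)
    define x where "x = cubic_seq r n"
    have x: "0 < x" "x < 1" using Suc by (auto simp: x_def)
    have "cubic_seq r (Suc n) ^ 3 < 1"
      using step[OF x(1)] cubic_arg_range[OF x] by (simp add: x_def)
    moreover have "0 < root 3 (9 * x * (1 + x + x\<^sup>2)) / (1 + 2 * x)"
      using x by (intro divide_pos_pos real_root_gt_zero mult_pos_pos add_pos_pos) auto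
    ultimately show ?case using less by (simp add: x_def)
  qed
  show "cubic_seq r n > 0" "cubic_seq r n < 1" using range by auto
  show "cubic_seq r (Suc n) ^ 3 = cubic_arg (cubic_seq r n)"
    using step[of "cubic_seq r n"] range[of n] by simp
qed

lemma cubic_base_ge_1: "cubic_base r n \<ge> 1"
proof -
  have "1 * 1 \<le> cubic_base r n"
    using cubic_seq_pos[of n] unfolding cubic_base_def by (intro mult_mono) auto
  thus ?thesis by simp
qed

lemma cubic_compl_0: "cubic_compl r 0 = r ^ 3"
  using r by (simp add: cubic_compl_def power_le_one)

lemma cubic_compl_pos: "cubic_compl r n > 0"
  using power_strict_mono[OF cubic_seq_less_1[of n], of 3] cubic_seq_pos[of n] by (simp add: cubic_compl_def)

lemma cubic_compl_less_1: "cubic_compl r n < 1"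
  using cubic_seq_pos[of n] by (simp add: cubic_compl_def)

text \<open>With x = r_n, factor 1 - x^3 as (1-x)(1+x+x^2); the quotient is then (1-x)/(1+2x). After
  taking logarithms this recursion makes the infinite product telescope.\<close>

lemma cubic_compl_Suc: "cubic_compl r (Suc n) = (cubic_compl r n / cubic_base r n) ^ 3"
proof -
  define x where "x = cubic_seq r n"
  have x: "x > 0" using cubic_seq_pos by (simp add: x_def)
  have "cubic_compl r n = (1 - x) * (1 + x + x\<^sup>2)"
    by (simp add: cubic_compl_def x_def algebra_simps power2_eq_square power3_eq_cube)
  moreover have "1 + x + x\<^sup>2 \<noteq> 0"
    using x add_pos_nonneg[of "1 + x" "x\<^sup>2"] by auto
  ultimately have "cubic_compl r n / cubic_base r n = (1 - x) / (1 + 2 * x)"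
    by (simp add: cubic_base_def x_def)
  thus ?thesis
    unfolding cubic_compl_def[of r "Suc n"] cubic_seq_Suc_cube by (simp add: cubic_arg_def x_def)
qed

text \<open>A crude geometric bound, enough for convergence to 0. The base is at least 1, so each
  step at least cubes a number in (0,1) that is at most r^3.\<close>

lemma cubic_compl_le: "cubic_compl r n \<le> (r ^ 3) ^ Suc n"
proof (induction n)
  case (Suc n)
  have c: "0 < cubic_compl r n" "cubic_compl r n < 1" by (rule cubic_compl_pos cubic_compl_less_1)+
  have "(r ^ 3) ^ Suc n \<le> r ^ 3"
    using r by (simp add: mult_left_le power_le_one)
  with Suc have le: "cubic_compl r n \<le> r ^ 3" by linarith
  have "cubic_compl r n / cubic_base r n \<le> cubic_compl r n"
    using c cubic_base_ge_1[of n] by (simp add: divide_le_eq mult_left_le)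
  hence "cubic_compl r (Suc n) \<le> cubic_compl r n ^ 3"
    unfolding cubic_compl_Suc using c cubic_base_ge_1[of n] by (intro power_mono divide_nonneg_pos) auto
  also have "\<dots> \<le> cubic_compl r n * cubic_compl r n"
    using c by (simp add: power3_eq_cube mult_left_le)
  also have "\<dots> \<le> r ^ 3 * (r ^ 3) ^ Suc n"
    using c le Suc r by (intro mult_mono) auto
  finally show ?case by simp
qed (simp add: cubic_compl_0)

lemma cubic_compl_tendsto: "filterlim (cubic_compl r) (at_right 0) sequentially"
proof -
  have lim: "(\<lambda>n. (r ^ 3) ^ Suc n) \<longlonglongrightarrow> 0"
    using r by (intro LIMSEQ_Suc LIMSEQ_realpow_zero) (auto simp: power_less_one_iff)
  have "cubic_compl r \<longlonglongrightarrow> 0"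
    by (rule tendsto_sandwich[OF _ _ tendsto_const lim])
       (auto intro!: always_eventually less_imp_le[OF cubic_compl_pos] cubic_compl_le simp del: power_Suc)
  thus ?thesis by (rule tendsto_imp_filterlim_at_right) (simp add: cubic_compl_pos)
qed

section \<open>The modulus and the product along the iteration\<close>

text \<open>The map x -> y = (1-x)/(1+2x) is an involution with (1+2x)(1+2y) = 3. The cubic
  transformation at x gives the new numerator, at y the old denominator, and the two multipliers
  combine to 3.\<close>

lemma hyp_ratio_cubic_compl_Suc: "hyp_ratio (1/3) (cubic_compl r (Suc n)) = 3 * hyp_ratio (1/3) (cubic_compl r n)"
proof -
  define x where "x = cubic_seq r n"
  define y where "y = (1 - x) / (1 + 2 * x)"
  have x: "0 < x" "x < 1" using cubic_seq_pos cubic_seq_less_1 by (auto simp: x_def)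
  have y: "0 < y" "y < 1" and xy: "1 + 2 * y = 3 / (1 + 2 * x)" "(1 - y) / (1 + 2 * y) = x"
    using x by (auto simp: y_def field_simps)
  have compl: "cubic_compl r (Suc n) = y ^ 3" "1 - cubic_compl r (Suc n) = cubic_arg x"
      "1 - cubic_compl r n = x ^ 3" "cubic_compl r n = cubic_arg y"
    using xy(2) by (auto simp: cubic_compl_def cubic_seq_Suc_cube cubic_arg_def x_def y_def
         simp del: cubic_seq.simps)
  have hx: "hyp (1/3) (cubic_arg x) = (1 + 2 * x) * hyp (1/3) (x ^ 3)"
    using x by (intro hyp_cubic_transformation) auto
  have hy: "hyp (1/3) (cubic_arg y) = 3 / (1 + 2 * x) * hyp (1/3) (y ^ 3)"
    using hyp_cubic_transformation[of y] y xy(1) by simp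
  show ?thesis
    using x unfolding hyp_ratio_def compl(2,3) unfolding compl(1,4) hx hy by simp
qed

text \<open>Write t_n for \<open>cubic_compl r n\<close>. The partial sums telescope to 3 ln r - ln
  t_n / 3^n, and ln t_n = -2 m(t_n) + O(1) with m(t_n) = 3^n m(r^3).\<close>

theorem cubic_log_sums:
  "(\<lambda>n. 1 / 3 ^ n * ln (cubic_base r n)) sums (3 * ln r + 2 * hyp_ratio (1/3) (r ^ 3))"
proof -
  let ?S = "\<lambda>n. \<Sum>k<n. 1 / 3 ^ k * ln (cubic_base r k)"
  have ratio: "hyp_ratio (1/3) (cubic_compl r n) = 3 ^ n * hyp_ratio (1/3) (r ^ 3)" for n
    by (induction n) (simp_all add: hyp_ratio_cubic_compl_Suc cubic_compl_0)
  have S: "?S n = 3 * ln r - ln (cubic_compl r n) / 3 ^ n" for n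
  proof (induction n)
    case 0
    thus ?case using r by (simp add: cubic_compl_0 ln_realpow)
  next
    case (Suc n)
    have "ln (cubic_compl r (Suc n)) = 3 * (ln (cubic_compl r n) - ln (cubic_base r n))"
      unfolding cubic_compl_Suc using cubic_compl_pos[of n] cubic_base_ge_1[of n]
      by (simp add: ln_realpow ln_div)
    hence "ln (cubic_compl r (Suc n)) / 3 ^ Suc n = ln (cubic_compl r n) / 3 ^ n - ln (cubic_base r n) / 3 ^ n"
      by (simp add: diff_divide_distrib)
    with Suc show ?case by simp
  qed
  have lim: "(\<lambda>n. hyp_ratio (1/3) (cubic_compl r n) + ln (cubic_compl r n) / 2) \<longlonglongrightarrow> ramanujan_R (1/3) / 2"
    using filterlim_compose[OF hyp_ratio_at_0[OF one_third_bounds] cubic_compl_tendsto] .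
  have power_tendsto: "(\<lambda>n. (1/3 :: real) ^ n) \<longlonglongrightarrow> 0"
    by (rule LIMSEQ_realpow_zero) auto
  have "(\<lambda>n. 3 * ln r + 2 * hyp_ratio (1/3) (r ^ 3)
      - 2 * ((1/3) ^ n * (hyp_ratio (1/3) (cubic_compl r n) + ln (cubic_compl r n) / 2)))
      \<longlonglongrightarrow> 3 * ln r + 2 * hyp_ratio (1/3) (r ^ 3) - 2 * (0 * (ramanujan_R (1/3) / 2))"
    by (intro tendsto_diff tendsto_mult tendsto_const lim power_tendsto)
  moreover have "3 * ln r + 2 * hyp_ratio (1/3) (r ^ 3)
      - 2 * ((1/3) ^ n * (hyp_ratio (1/3) (cubic_compl r n) + ln (cubic_compl r n) / 2)) = ?S n" for n
    unfolding S ratio by (simp add: field_simps)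
  ultimately show ?thesis by (simp add: sums_def)
qed

lemma cubic_factor_eq: "cubic_factor r n = exp (1/2 * (1 / 3 ^ n * ln (cubic_base r n)))"
proof -
  have "(3::real) powi (- int n) = 1 / 3 ^ n"
    by (simp add: power_int_minus divide_inverse)
  thus ?thesis using cubic_base_ge_1[of n] by (simp add: cubic_factor_def powr_def)
qed

end

section \<open>The bounds, their equality cases and the product formula\<close>

theorem theorem1p2:
  fixes a r :: real
  assumes "a \<in> {0<..1/2}" and "r \<in> {0<..<1}"
  shows "convergent_prod (cubic_factor r) \<and>
    (a \<in> {0<..1/3} \<longrightarrow>
       (\<Prod>n. cubic_factor r n) \<le> exp (mu_star a r + 3/2 * ln r) \<and>
       exp (mu_star a r + 3/2 * ln r)
         \<le> 1 / sqrt 27 * exp (ramanujan_R a / 2) * (\<Prod>n. cubic_factor r n)) \<and>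
    (a \<in> {1/3..1/2} \<longrightarrow>
       1 / sqrt 27 * exp (ramanujan_R a / 2) * (\<Prod>n. cubic_factor r n)
         \<le> exp (mu_star a r + 3/2 * ln r) \<and>
       exp (mu_star a r + 3/2 * ln r) \<le> (\<Prod>n. cubic_factor r n)) \<and>
    (exp (mu_star a r + 3/2 * ln r) = (\<Prod>n. cubic_factor r n) \<longleftrightarrow> a = 1/3) \<and>
    (exp (mu_star a r + 3/2 * ln r)
       = 1 / sqrt 27 * exp (ramanujan_R a / 2) * (\<Prod>n. cubic_factor r n) \<longleftrightarrow> a = 1/3) \<and>
    exp (mu_star (1/3) r + 3/2 * ln r) = exp (mu (1/3) (r powr (3/2)) + 3/2 * ln r) \<and>
    exp (mu (1/3) (r powr (3/2)) + 3/2 * ln r) = (\<Prod>n. cubic_factor r n) \<and>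
    mu_star (1/3) r + 3/2 * ln r = mu (1/3) (r powr (3/2)) + 3/2 * ln r \<and>
    summable (\<lambda>n. 1 / 3 ^ n * ln (cubic_base r n)) \<and>
    mu (1/3) (r powr (3/2)) + 3/2 * ln r
      = 1/2 * (\<Sum>n. 1 / 3 ^ n * ln (cubic_base r n))"
proof -
  have a: "0 < a" "a < 1" "a \<le> 1/2" and r: "0 < r" "r < 1" using assms by auto
  have r3: "0 < r ^ 3" "r ^ 3 < 1" using r by (auto simp: power_less_one_iff)
  define M where "M a = hyp_ratio a (r ^ 3)" for a
  have mu: "mu_star a r = M a" "mu a (r powr (3/2)) = M a" for a
    using mu_eq_hyp_ratio[OF r(1)] by (auto simp: mu_star_def M_def)
  have sums: "(\<lambda>n. 1 / 3 ^ n * ln (cubic_base r n)) sums (3 * ln r + 2 * M (1/3))"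
    using cubic_log_sums[OF r] by (simp add: M_def)
  have half: "(\<lambda>n. 1/2 * (1 / 3 ^ n * ln (cubic_base r n))) sums (M (1/3) + 3/2 * ln r)"
    using sums_mult[OF sums, of "1/2"] by (simp add: algebra_simps)
  have factor: "cubic_factor r = (\<lambda>n. exp (1/2 * (1 / 3 ^ n * ln (cubic_base r n))))"
    by (rule ext) (rule cubic_factor_eq[OF r])
  have conv: "convergent_prod (cubic_factor r)"
    unfolding factor by (rule convergent_prod_exp) (rule sums_summable[OF half])
  have prod: "(\<Prod>n. cubic_factor r n) = exp (M (1/3) + 3/2 * ln r)"
    unfolding factor using prodinf_exp[OF sums_summable[OF half]] sums_unique[OF half] by simp
  \<comment> \<open>The logarithm of exp(R(a)/2)/sqrt 27, since sqrt 27 = exp(R(1/3)/2); every claim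
    about exponentials thereby becomes a comparison of exponents.\<close>
  define c where "c = (ramanujan_R a - ramanujan_R (1/3)) / 2"
  have "exp (ramanujan_R (1/3) / 2) = exp (ln (sqrt 27))"
    by (simp add: ramanujan_R_third ln_sqrt)
  also have "\<dots> = sqrt 27" by simp
  finally have "sqrt 27 = exp (ramanujan_R (1/3) / 2)" ..
  hence bound: "1 / sqrt 27 * exp (ramanujan_R a / 2) * (\<Prod>n. cubic_factor r n) = exp (c + M (1/3) + 3/2 * ln r)"
    unfolding prod c_def by (simp add: exp_add exp_diff diff_divide_distrib)
  have "M (1/3) < M a \<and> M a - M (1/3) < c" if "a < 1/3"
    using hyp_ratio_diff_bounds[of a "1/3" "r ^ 3"] that a r3 by (simp add: M_def c_def)
  moreover have "M a < M (1/3) \<and> c < M a - M (1/3)" if "a > 1/3"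
    using hyp_ratio_diff_bounds[of "1/3" a "r ^ 3"] that a r3
    by (simp add: M_def c_def diff_divide_distrib)
  moreover have "c = 0 \<and> M a = M (1/3)" if "a = 1/3" unfolding c_def that by simp
  \<comment> \<open>Both comparisons are strict off 1/3, which settles the inequalities and the
    equality cases together.\<close>
  ultimately have cases:
    "a < 1/3 \<and> M (1/3) < M a \<and> M a - M (1/3) < c \<or> a = 1/3 \<and> c = 0 \<and> M a = M (1/3) \<or>
     a > 1/3 \<and> M a < M (1/3) \<and> c < M a - M (1/3)"
    using linorder_less_linear[of a "1/3"] by blast
  show ?thesis
    unfolding mu bound unfolding prod exp_le_cancel_iff exp_inj_iff
    using cases conv sums_summable[OF sums] sums_unique[OF sums] by auto
qed

end
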